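(* Let $p$ be a prime number, let $n>1$ be an integer, and let $\mathcal{F}(\mathbb{Z}_{p^n})^\times$ be the group of unit-valued polynomial functions modulo $p^n$. Then $$|\mathcal{F}(\mathbb{Z}_{p^n})^\times|=(p-1)^p\, p^{\sum_{k=2}^{n}\beta(k)}.$$
   Context: $\mathbb{Z}_{m}$ denotes the ring of integers modulo $m$. A polynomial function on a ring $R$ is a function $R\to R$ of the form $r\mapsto f(r)$ with $f\in R[x]$; $\mathcal{F}(R)$ is the commutative ring of polynomial functions on $R$ under pointwise operations, and $\mathcal{F}(R)^\times$ is its group of units, which for finite $R$ consists exactly of the polynomial functions all of whose values lie in $R^\times$ (unit-valued polynomial functions). For the fixed prime $p$ and a positive integer $k$, $\beta(k)$ denotes the smallest positive integer $m$ such that $p^k\mid m!$. *)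

theory Defs
  imports "HOL-Number_Theory.Residues"
begin

text \<open>
  Functions on the carrier of R are represented extensionally
  (\<open>undefined\<close> outside the carrier), so that equality of polynomial functions
  means agreement at every element of R.
\<close>

definition poly_function :: "('a, 'b) ring_scheme \<Rightarrow> (nat \<Rightarrow> 'a) \<Rightarrow> 'a \<Rightarrow> 'a" where
  "poly_function R f = (\<lambda>r\<in>carrier R. eval R R id r f)"

definition poly_function_ring :: "('a, 'b) ring_scheme \<Rightarrow> ('a \<Rightarrow> 'a) ring" where
  "poly_function_ring R =
     \<lparr>carrier = poly_function R ` carrier (UP R),
      monoid.mult = (\<lambda>F G. \<lambda>r\<in>carrier R. F r \<otimes>\<^bsub>R\<^esub> G r),
      one = (\<lambda>r\<in>carrier R. \<one>\<^bsub>R\<^esub>),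
      zero = (\<lambda>r\<in>carrier R. \<zero>\<^bsub>R\<^esub>),
      add = (\<lambda>F G. \<lambda>r\<in>carrier R. F r \<oplus>\<^bsub>R\<^esub> G r)\<rparr>"

lemma (in cring) poly_function_ring_cring: "cring (poly_function_ring R)"
proof -
  have R: "cring R" by unfold_locales
  interpret UP_cring R "UP R" by unfold_locales simp
  have H: "eval R R id r \<in> ring_hom (UP R) R" if "r \<in> carrier R" for r
  proof -
    interpret UP_pre_univ_prop R R id "UP R"
      by (intro UP_pre_univ_prop.intro ring_hom_cring.intro UP_cring.intro
            ring_hom_cring_axioms.intro)
         (auto intro!: ring_hom_memI simp: R)
    show ?thesis using eval_ring_hom[OF that] by simp
  qed
  let ?F = "poly_function_ring R"
  have car: "carrier ?F = poly_function R ` carrier (UP R)"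
    by (simp add: poly_function_ring_def)
  have add: "poly_function R f \<oplus>\<^bsub>?F\<^esub> poly_function R g = poly_function R (f \<oplus>\<^bsub>UP R\<^esub> g)"
    if "f \<in> carrier (UP R)" "g \<in> carrier (UP R)" for f g
    using ring_hom_add[OF H that] by (auto simp: poly_function_ring_def poly_function_def)
  have mult: "poly_function R f \<otimes>\<^bsub>?F\<^esub> poly_function R g = poly_function R (f \<otimes>\<^bsub>UP R\<^esub> g)"
    if "f \<in> carrier (UP R)" "g \<in> carrier (UP R)" for f g
    using ring_hom_mult[OF H that] by (auto simp: poly_function_ring_def poly_function_def)
  have one: "\<one>\<^bsub>?F\<^esub> = poly_function R \<one>\<^bsub>UP R\<^esub>"
    using ring_hom_one[OF H] by (auto simp: poly_function_ring_def poly_function_def)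
  have zero: "\<zero>\<^bsub>?F\<^esub> = poly_function R \<zero>\<^bsub>UP R\<^esub>"
    using ring_hom_zero[OF H P.ring_axioms cring.axioms(1)[OF R]]
    by (auto simp: poly_function_ring_def poly_function_def)
  note rs = add[symmetric] mult[symmetric] one[symmetric] zero[symmetric]
  show ?thesis
  proof (rule cringI)
    show "abelian_group ?F"
    proof (rule abelian_groupI)
      fix x assume "x \<in> carrier ?F"
      then obtain f where f: "f \<in> carrier (UP R)" "x = poly_function R f" by (auto simp: car)
      show "\<exists>y\<in>carrier ?F. y \<oplus>\<^bsub>?F\<^esub> x = \<zero>\<^bsub>?F\<^esub>"
        by (rule bexI[of _ "poly_function R (\<ominus>\<^bsub>UP R\<^esub> f)"])
           (use f in \<open>auto simp: car add zero P.l_neg\<close>)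
    qed (auto simp: car add zero P.a_ac)
    show "comm_monoid ?F"
      by (rule comm_monoidI) (auto simp: car mult one P.m_ac)
  qed (auto simp: car add mult P.l_distr)
qed

text \<open>For \<open>p > 0\<close> the least element exists, since \<open>p ^ k\<close> divides \<open>fact (p ^ k)\<close>.\<close>

definition beta :: "nat \<Rightarrow> nat \<Rightarrow> nat" where
  "beta p k = (LEAST m. m > 0 \<and> p ^ k dvd (fact m :: nat))"

end

theory Submission
  imports Defs
begin

text \<open>
  Put \<open>M = p ^ n\<close> and determine a unit-valued polynomial function by choosing its values at
  \<open>0, 1, 2, \<dots>\<close> in turn. By Newton interpolation, the values below \<open>x\<close> fix the value at \<open>x\<close>
  modulo \<open>gcd M (fact x)\<close>, and adding multiples of the falling factorial of length \<open>x\<close> realises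
  every residue in that class. If \<open>x < p\<close>, the gcd is \<open>1\<close> and only the unit condition remains; if
  \<open>x \<ge> p\<close>, the value at \<open>x\<close> is congruent modulo \<open>p\<close> to the one at \<open>x - p\<close>, hence automatically a
  unit. So the number of choices at \<open>x\<close> is \<open>p - 1\<close> (if \<open>x < p\<close>) or \<open>1\<close> (otherwise), times \<open>p\<close> to the
  number of \<open>k \<in> {2..n}\<close> such that \<open>p ^ k\<close> does not divide \<open>fact x\<close>, that is, \<open>x < beta p k\<close>.
  Multiplying over \<open>x < M\<close> and exchanging the sums in the exponent gives the formula.
\<close>

section \<open>Integer polynomial functions and the factor theorem\<close>

text \<open>These are the functions on the integers induced by integer polynomials. Generating them
  by closure gives rule induction in place of computations with coefficients, and they can be
  evaluated at any integer, not just at residues.\<close>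

inductive int_polyfun :: "(int \<Rightarrow> int) \<Rightarrow> bool" where
  const: "int_polyfun (\<lambda>_. c)"
| ident: "int_polyfun (\<lambda>x. x)"
| add: "int_polyfun f \<Longrightarrow> int_polyfun g \<Longrightarrow> int_polyfun (\<lambda>x. f x + g x)"
| mult: "int_polyfun f \<Longrightarrow> int_polyfun g \<Longrightarrow> int_polyfun (\<lambda>x. f x * g x)"

lemma int_polyfun_power: "int_polyfun f \<Longrightarrow> int_polyfun (\<lambda>x. f x ^ k)"
  by (induction k) (auto intro: int_polyfun.intros)

lemma int_polyfun_sum:
  "finite A \<Longrightarrow> (\<And>i. i \<in> A \<Longrightarrow> int_polyfun (f i)) \<Longrightarrow> int_polyfun (\<lambda>x. \<Sum>i\<in>A. f i x)"
  by (induction A rule: finite_induct) (auto intro: int_polyfun.intros)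

lemma int_polyfun_prod:
  "finite A \<Longrightarrow> (\<And>i. i \<in> A \<Longrightarrow> int_polyfun (f i)) \<Longrightarrow> int_polyfun (\<lambda>x. \<Prod>i\<in>A. f i x)"
  by (induction A rule: finite_induct) (auto intro: int_polyfun.intros)

lemma int_polyfun_diff:
  assumes "int_polyfun f" "int_polyfun g"
  shows "int_polyfun (\<lambda>x. f x - g x)"
  using int_polyfun.add[OF assms(1) int_polyfun.mult[OF int_polyfun.const[of "-1"] assms(2)]] by simp

lemma int_polyfun_factor:
  assumes "int_polyfun f"
  shows "\<exists>q. int_polyfun q \<and> (\<forall>x. f x = f c + (x - c) * q x)"
  using assms
proof induction
  case (const a)
  show ?case by (rule exI[of _ "\<lambda>_. 0"]) (auto intro: int_polyfun.intros)
next
  case ident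
  show ?case by (rule exI[of _ "\<lambda>_. 1"]) (auto intro: int_polyfun.intros)
next
  case (add f g)
  then obtain q r where q: "int_polyfun q" "\<And>x. f x = f c + (x - c) * q x"
    and r: "int_polyfun r" "\<And>x. g x = g c + (x - c) * r x" by blast
  have "f x + g x = f c + g c + (x - c) * (q x + r x)" for x
    by (subst q(2), subst r(2)) (simp add: algebra_simps)
  then show ?case using int_polyfun.add[OF q(1) r(1)] by blast
next
  case (mult f g)
  then obtain q r where q: "int_polyfun q" "\<And>x. f x = f c + (x - c) * q x"
    and r: "int_polyfun r" "\<And>x. g x = g c + (x - c) * r x" by blast
  \<comment> \<open>From \<open>f x * g x - f c * g c = f c * (g x - g c) + (f x - f c) * g
    x\<close>; the cofactor stays polynomial because \<open>g\<close> itself is.\<close>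
  have "f x * g x = f c * g c + (x - c) * (f c * r x + q x * g x)" for x
  proof -
    have "f x * g x = (f c + (x - c) * q x) * g x" using q(2)[of x] by simp
    also have "\<dots> = f c * (g c + (x - c) * r x) + (x - c) * q x * g x"
      using r(2)[of x] by (simp add: distrib_right)
    finally show ?thesis by (simp add: algebra_simps)
  qed
  moreover have "int_polyfun (\<lambda>x. f c * r x + q x * g x)"
    by (intro int_polyfun.intros q r mult)
  ultimately show ?case by blast
qed

lemma int_polyfun_cong:
  assumes "int_polyfun f" "[x = y] (mod m)"
  shows "[f x = f y] (mod m)"
proof -
  obtain q where "f x = f y + (x - y) * q x"
    using int_polyfun_factor[OF assms(1)] by blast
  then show ?thesis using assms(2) by (auto simp: cong_iff_dvd_diff)
qed

section \<open>Newton interpolation modulo M\<close>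

text \<open>The quotient is the generalised binomial coefficient, an integer for negative
  \<open>y\<close> as well.\<close>

lemma fact_dvd_falling: "(fact m :: int) dvd (\<Prod>i<m. y - int i)"
  unfolding lessThan_atLeast0 by (rule dvdI[OF gbinomial_int_mult_fact[symmetric]])

text \<open>Newton interpolation at \<open>0, \<dots>, m - 1\<close>, where all lower terms vanish modulo \<open>M\<close>.\<close>

lemma int_polyfun_vanishing:
  assumes "int_polyfun h" "\<And>i. i < m \<Longrightarrow> M dvd h (int i)"
  shows "\<exists>q. int_polyfun q \<and> (\<forall>y. [h y = (\<Prod>i<m. y - int i) * q y] (mod M))"
  using assms(2)
proof (induction m)
  case 0
  show ?case using assms(1) by auto
next
  case (Suc m)
  then obtain q where q: "int_polyfun q" "\<And>y. [h y = (\<Prod>i<m. y - int i) * q y] (mod M)"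
    by force
  obtain r where r: "int_polyfun r" "\<And>y. q y = q (int m) + (y - int m) * r y"
    using int_polyfun_factor[OF q(1)] by blast
  have "(\<Prod>i<m. int m - int i) = fact m"
    by (simp add: fact_prod_rev lessThan_atLeast0 of_nat_diff)
  \<comment> \<open>At \<open>y = m\<close> the product is \<open>fact m\<close>, and
    \<open>h\<close> vanishes there modulo \<open>M\<close>. Since \<open>fact m\<close> divides the
    falling factorial of length \<open>m\<close> at every \<open>y\<close>, the constant part
    \<open>q (int m)\<close> then contributes nothing modulo \<open>M\<close>.\<close>
  with q(2)[of "int m"] Suc.prems[of m] have *: "M dvd fact m * q (int m)"
    by (simp add: cong_dvd_iff)
  have "[h y = (\<Prod>i<Suc m. y - int i) * r y] (mod M)" for y
  proof -
    have eq: "(\<Prod>i<m. y - int i) * q y = (\<Prod>i<m. y - int i) * q (int m) + (\<Prod>i<Suc m. y - int i) * r y"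
      by (subst r(2)) (simp add: algebra_simps)
    have "M dvd (\<Prod>i<m. y - int i) * q (int m)"
      using * fact_dvd_falling[of m y] by (meson dvd_trans dvd_refl mult_dvd_mono)
    then show ?thesis
      using q(2)[of y] unfolding eq
      by (smt (verit) cong_iff_dvd_diff dvd_add_left_iff)
  qed
  with r(1) show ?case by blast
qed

text \<open>The difference \<open>f - g\<close> vanishes modulo \<open>M\<close> at all
  \<open>i < m\<close>, so modulo \<open>M\<close> it is a multiple of the falling factorial, whose
  value at \<open>m\<close> is \<open>fact m\<close>.\<close>

lemma int_polyfun_next_value:
  assumes "int_polyfun f" "int_polyfun g" "\<And>i. i < m \<Longrightarrow> [f (int i) = g (int i)] (mod M)"
  shows "[f (int m) = g (int m)] (mod gcd M (fact m))"
proof -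
  obtain q where "[f (int m) - g (int m) = (\<Prod>i<m. int m - int i) * q (int m)] (mod M)"
    using int_polyfun_vanishing[OF int_polyfun_diff[OF assms(1,2)], of m M] assms(3)
    by (auto simp: cong_iff_dvd_diff)
  moreover have "(\<Prod>i<m. int m - int i) = fact m"
    by (simp add: fact_prod_rev lessThan_atLeast0 of_nat_diff)
  ultimately have "[f (int m) - g (int m) = fact m * q (int m)] (mod gcd M (fact m))"
    by (metis cong_dvd_modulus gcd_dvd1)
  then show ?thesis
    by (simp add: cong_iff_dvd_diff) (metis dvd_diff_commute dvd_mult2 gcd_dvd2 dvd_diffD1 dvd_diff cong_dvd_iff cong_iff_dvd_diff)
qed

lemma card_cong_class:
  fixes M g c :: int
  assumes "g > 0" "M > 0" "g dvd M"
  shows "card {v \<in> {0..<M}. [v = c] (mod g)} = nat (M div g)"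
proof -
  \<comment> \<open>Each of the \<open>M div g\<close> blocks of \<open>g\<close> consecutive
    integers contains exactly one member of the class, at offset \<open>c mod g\<close>.\<close>
  have "bij_betw (\<lambda>k. c mod g + g * k) {0..<M div g} {v \<in> {0..<M}. [v = c] (mod g)}"
  proof (rule bij_betw_byWitness[where f' = "\<lambda>v. v div g"])
    show "\<forall>k\<in>{0..<M div g}. (c mod g + g * k) div g = k"
      using assms by auto
    show "\<forall>v\<in>{v \<in> {0..<M}. [v = c] (mod g)}. c mod g + g * (v div g) = v"
      by (auto simp: cong_def) (metis mod_mult_div_eq)
    have "c mod g + g * k < M" if "k < M div g" for k
    proof -
      have "c mod g + g * k < g * (k + 1)" using assms by (simp add: algebra_simps)
      also have "\<dots> \<le> g * (M div g)" using that assms by (intro mult_left_mono) auto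
      finally show ?thesis using assms by simp
    qed
    then show "(\<lambda>k. c mod g + g * k) ` {0..<M div g} \<subseteq> {v \<in> {0..<M}. [v = c] (mod g)}"
      using assms by (auto simp: cong_def)
    have "v div g < M div g" if "v < M" for v
    proof -
      have "g * (v div g) \<le> v" using assms by (simp add: minus_mod_eq_mult_div [symmetric])
      then have "g * (v div g) < g * (M div g)" using that assms by simp
      then show ?thesis using assms(1) mult_less_cancel_left_pos by blast
    qed
    then show "(\<lambda>v. v div g) ` {v \<in> {0..<M}. [v = c] (mod g)} \<subseteq> {0..<M div g}"
      using assms by (auto simp: pos_imp_zdiv_nonneg_iff)
  qed
  from bij_betw_same_card[OF this] show ?thesis by simp
qed

section \<open>The ring of polynomial functions modulo m and its units\<close>

lemma (in residues) finsum_mod: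
  "finite A \<Longrightarrow> (\<Oplus>i\<in>A. g i mod m) = (\<Sum>i\<in>A. g i) mod m"
  by (induction A rule: finite_induct) (auto simp: zero_cong add_cong)

text \<open>Translates the abstract ring into integer arithmetic: evaluating a polynomial modulo
  \<open>m\<close> is reducing the integer value. Conversely, constants and the identity come from
  monomials, and closure of the ring under its operations handles sums and products.\<close>

lemma (in residues) carrier_poly_function_ring:
  "carrier (poly_function_ring R) = {\<lambda>r\<in>{0..<m}. f r mod m | f. int_polyfun f}"
    (is "?C = ?V")
proof
  have car: "carrier R = {0..<m}"
    by (auto simp: res_carrier_eq)
  show "?C \<subseteq> ?V"
  proof
    fix F assume "F \<in> ?C"
    then obtain f where f: "f \<in> carrier (UP R)" "F = poly_function R f"
      by (auto simp: poly_function_ring_def)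
    have "eval R R id r f = (\<Sum>i\<le>deg R f. f i * r ^ i) mod m" if "r \<in> {0..<m}" for r
    proof -
      have "f i \<otimes> r [^] i = (f i * r ^ i) mod m" for i
        using pow_cong[of r i] that by (simp add: res_mult_eq mod_mult_right_eq)
      then show ?thesis
        using f(1) finsum_mod[of "{..deg R f}" "\<lambda>i. f i * r ^ i"]
        by (simp add: eval_def) (simp add: UP_def)
    qed
    then have "F = (\<lambda>r\<in>{0..<m}. (\<Sum>i\<le>deg R f. f i * r ^ i) mod m)"
      unfolding f(2) poly_function_def car by (intro restrict_ext) auto
    moreover have "int_polyfun (\<lambda>r. \<Sum>i\<le>deg R f. f i * r ^ i)"
      by (intro int_polyfun_sum int_polyfun_power int_polyfun.intros) auto
    ultimately show "F \<in> ?V" by (intro CollectI exI conjI)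
  qed
  interpret F: cring "poly_function_ring R" by (rule poly_function_ring_cring)
  interpret UP_pre_univ_prop R R id "UP R"
    by (intro UP_pre_univ_prop.intro ring_hom_cring.intro UP_cring.intro
          ring_hom_cring_axioms.intro)
       (auto intro!: ring_hom_memI simp: cring)
  show "?V \<subseteq> ?C"
  proof clarify
    fix f assume "int_polyfun f"
    then show "(\<lambda>r\<in>{0..<m}. f r mod m) \<in> ?C"
    proof induction
      case (const c)
      have "(\<lambda>r\<in>{0..<m}. c mod m) = poly_function R (monom (UP R) (c mod m) 0)"
        unfolding poly_function_def car by (intro restrict_ext) (simp add: eval_const car)
      then show ?case by (auto simp: poly_function_ring_def)
    next
      case ident
      have "(\<lambda>r\<in>{0..<m}. r mod m) = poly_function R (monom (UP R) \<one> 1)"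
        unfolding poly_function_def car by (intro restrict_ext) (simp add: eval_monom1 car del: One_nat_def)
      then show ?case by (auto simp: poly_function_ring_def)
    next
      case (add f g)
      have eq: "(\<lambda>r\<in>{0..<m}. f r mod m) \<oplus>\<^bsub>poly_function_ring R\<^esub> (\<lambda>r\<in>{0..<m}. g r mod m)
          = (\<lambda>r\<in>{0..<m}. (f r + g r) mod m)"
        by (auto simp: poly_function_ring_def car add_cong fun_eq_iff)
      show ?case using F.a_closed[OF add.IH] unfolding eq .
    next
      case (mult f g)
      have eq: "(\<lambda>r\<in>{0..<m}. f r mod m) \<otimes>\<^bsub>poly_function_ring R\<^esub> (\<lambda>r\<in>{0..<m}. g r mod m)
          = (\<lambda>r\<in>{0..<m}. (f r * g r) mod m)"
        by (auto simp: poly_function_ring_def car mult_cong fun_eq_iff)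
      show ?case using F.m_closed[OF mult.IH] unfolding eq .
    qed
  qed
qed


lemma (in residues) Units_poly_function_ring:
  "Units (poly_function_ring R) =
     {\<lambda>r\<in>{0..<m}. f r mod m | f. int_polyfun f \<and> (\<forall>r\<in>{0..<m}. coprime (f r) m)}"
    (is "?U = ?V")
proof
  have car: "carrier R = {0..<m}"
    by (auto simp: res_carrier_eq)
  show "?U \<subseteq> ?V"
  proof
    fix F assume "F \<in> ?U"
    then obtain G where FG: "F \<in> carrier (poly_function_ring R)" "G \<in> carrier (poly_function_ring R)"
      "F \<otimes>\<^bsub>poly_function_ring R\<^esub> G = \<one>\<^bsub>poly_function_ring R\<^esub>"
      by (auto simp: Units_def)
    obtain f g where f: "F = (\<lambda>r\<in>{0..<m}. f r mod m)" "int_polyfun f"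
      and g: "G = (\<lambda>r\<in>{0..<m}. g r mod m)"
      using FG(1,2) unfolding carrier_poly_function_ring by blast
    have "coprime (f r) m" if r: "r \<in> {0..<m}" for r
    proof -
      from FG(3) have "(F \<otimes>\<^bsub>poly_function_ring R\<^esub> G) r = \<one>\<^bsub>poly_function_ring R\<^esub> r"
        by simp
      then have "(f r * g r) mod m = 1"
        using r unfolding f(1) g by (simp add: poly_function_ring_def car mult_cong res_one_eq)
      then have "[f r * g r = 1] (mod m)"
        using m_gt_one by (simp add: cong_def)
      then show ?thesis
        by (auto simp: coprime_iff_invertible_int)
    qed
    with f show "F \<in> ?V" by blast
  qed
  show "?V \<subseteq> ?U"
  proof clarify
    fix f assume f: "int_polyfun f" "\<forall>r\<in>{0..<m}. coprime (f r) m"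
    define t where "t = totient (nat m)"
    have "t > 0" using m_gt_one by (simp add: t_def)
    \<comment> \<open>A pointwise inverse has to be polynomial again. By Euler's theorem the power
      of \<open>f\<close> with exponent \<open>t - 1\<close> is one; \<open>t > 0\<close> makes the
      subtraction exact.\<close>
    define g where "g = (\<lambda>r. f r ^ (t - 1))"
    have g: "int_polyfun g" unfolding g_def by (intro int_polyfun_power f)
    have fg: "(f r * g r) mod m = 1" if "r \<in> {0..<m}" for r
    proof -
      have "f r * g r = f r ^ t"
        using \<open>t > 0\<close> by (simp add: g_def flip: power_Suc)
      moreover have "[f r ^ t = 1] (mod m)"
        unfolding t_def using f(2) that by (intro euler_theorem) auto
      ultimately show ?thesis using m_gt_one by (simp add: cong_def)
    qed
    let ?F = "\<lambda>r\<in>{0..<m}. f r mod m" and ?G = "\<lambda>r\<in>{0..<m}. g r mod m"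
    have "?F \<in> carrier (poly_function_ring R)" "?G \<in> carrier (poly_function_ring R)"
      using f(1) g unfolding carrier_poly_function_ring by blast+
    moreover have "?F \<otimes>\<^bsub>poly_function_ring R\<^esub> ?G = \<one>\<^bsub>poly_function_ring R\<^esub>"
      "?G \<otimes>\<^bsub>poly_function_ring R\<^esub> ?F = \<one>\<^bsub>poly_function_ring R\<^esub>"
      using fg by (auto simp: poly_function_ring_def car mult_cong res_one_eq mult.commute
        intro!: restrict_ext)
    ultimately show "?F \<in> ?U" by (auto simp: Units_def)
  qed
qed

section \<open>Counting tables of values point by point\<close>

text \<open>The unit condition is imposed only below \<open>x\<close>, so tables can grow one
  argument at a time; at \<open>x = p ^ n\<close> they are exactly the units of the ring.\<close>

definition unit_values :: "nat \<Rightarrow> nat \<Rightarrow> nat \<Rightarrow> (int \<Rightarrow> int) set" where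
  "unit_values p n x =
     {\<lambda>i\<in>{0..<int x}. f i mod int (p ^ n) | f.
        int_polyfun f \<and> (\<forall>i\<in>{0..<int x}. coprime (f i) (int p))}"

lemma finite_unit_values:
  assumes "p > 0"
  shows "finite (unit_values p n x)"
proof (rule finite_subset)
  show "unit_values p n x \<subseteq> {0..<int x} \<rightarrow>\<^sub>E {0..<int (p ^ n)}"
    using assms by (auto simp: unit_values_def PiE_iff extensional_def)
  show "finite ({0..<int x} \<rightarrow>\<^sub>E {0..<int (p ^ n)})"
    by (intro finite_PiE) auto
qed

lemma coprime_prime_power_cong:
  fixes p n :: nat and a b :: int
  assumes "[a = b] (mod int (p ^ n))" "n > 0"
  shows "coprime a (int p) \<longleftrightarrow> coprime b (int p)"
proof -
  have "[a = b] (mod int p)"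
    using assms by (metis cong_dvd_modulus dvd_power of_nat_power)
  then show ?thesis by (metis cong_imp_coprime cong_sym)
qed

text \<open>The congruence is necessary by \<open>int_polyfun_next_value\<close>. It is sufficient
  because a multiple of the falling factorial of length \<open>x\<close> changes the value at
  \<open>x\<close> without disturbing the earlier ones.\<close>

lemma unit_values_extensions:
  fixes p n x :: nat
  assumes "p > 0" "n > 0" and f: "int_polyfun f" "\<forall>i\<in>{0..<int x}. coprime (f i) (int p)"
  defines "M \<equiv> int (p ^ n)"
  shows "{v. (\<lambda>i\<in>{0..<int x}. f i mod M)(int x := v) \<in> unit_values p n (Suc x)} =
    {v \<in> {0..<M}. coprime v (int p) \<and> [v = f (int x)] (mod gcd M (fact x))}" (is "?L = ?R")
proof (intro equalityI subsetI)
  fix v assume "v \<in> ?L"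
  then obtain g where g: "int_polyfun g" "\<forall>i\<in>{0..<int (Suc x)}. coprime (g i) (int p)"
    and eq: "(\<lambda>i\<in>{0..<int x}. f i mod M)(int x := v) = (\<lambda>i\<in>{0..<int (Suc x)}. g i mod M)"
    unfolding unit_values_def M_def by blast
  have v: "v = g (int x) mod M" using fun_cong[OF eq, of "int x"] by simp
  have "[g (int i) = f (int i)] (mod M)" if "i < x" for i
    using fun_cong[OF eq, of "int i"] that by (simp add: cong_def)
  from int_polyfun_next_value[OF g(1) f(1) this]
  have "[g (int x) = f (int x)] (mod gcd M (fact x))" by simp
  moreover have vg: "[v = g (int x)] (mod M)" by (simp add: v cong_def)
  ultimately have "[v = f (int x)] (mod gcd M (fact x))"
    by (meson cong_dvd_modulus cong_trans gcd_dvd1)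
  moreover have "coprime v (int p)"
    using vg g(2) \<open>n > 0\<close> coprime_prime_power_cong unfolding M_def by fastforce
  ultimately show "v \<in> ?R" using \<open>p > 0\<close> by (simp add: v M_def)
next
  fix v assume "v \<in> ?R"
  then have v: "0 \<le> v" "v < M" "coprime v (int p)" "[v = f (int x)] (mod gcd M (fact x))"
    by auto
  from v(4) obtain k where k: "v - f (int x) = gcd M (fact x) * k"
    unfolding cong_iff_dvd_diff by (auto elim: dvdE)
  obtain u w where uw: "u * M + w * fact x = gcd M (fact x)"
    using bezout_int by blast
  \<comment> \<open>The correction is zero at \<open>0, ..., x - 1\<close>. At \<open>x\<close> it
    is \<open>w * k * fact x\<close>, which by Bezout is congruent modulo \<open>M\<close> to
    \<open>gcd M (fact x) * k = v - f (int x)\<close>.\<close>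
  define g where "g = (\<lambda>y. f y + w * k * (\<Prod>i<x. y - int i))"
  have g: "int_polyfun g"
    unfolding g_def by (intro int_polyfun.intros int_polyfun_prod int_polyfun_diff f) auto
  have eqf: "g i = f i" if "i \<in> {0..<int x}" for i
  proof -
    have "nat i \<in> {..<x}" "i - int (nat i) = 0" using that by auto
    then have "(\<Prod>j<x. i - int j) = 0" by (metis prod_zero finite_lessThan)
    then show ?thesis by (simp add: g_def)
  qed
  have "(\<Prod>i<x. int x - int i) = fact x"
    by (simp add: fact_prod_rev lessThan_atLeast0 of_nat_diff)
  then have "v - g (int x) = M * (u * k)"
    using k by (simp add: g_def flip: uw) (simp add: algebra_simps)
  then have vg: "[v = g (int x)] (mod M)" by (simp add: cong_iff_dvd_diff)
  then have "v = g (int x) mod M" using v(1,2) by (simp add: cong_def)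
  then have "(\<lambda>i\<in>{0..<int x}. f i mod M)(int x := v) = (\<lambda>i\<in>{0..<int (Suc x)}. g i mod M)"
    using eqf by (auto simp: fun_eq_iff)
  moreover have "coprime (g i) (int p)" if "i \<in> {0..<int (Suc x)}" for i
  proof (cases "i = int x")
    case True
    then show ?thesis
      using vg v(3) \<open>n > 0\<close> coprime_prime_power_cong unfolding M_def by blast
  next
    case False
    then show ?thesis using eqf[of i] f(2) that by auto
  qed
  ultimately show "v \<in> ?L" using g unfolding unit_values_def M_def by blast
qed

lemma card_extensions:
  fixes p n x :: nat
  assumes "prime p" "n > 0" and f: "int_polyfun f" "\<forall>i\<in>{0..<int x}. coprime (f i) (int p)"
  defines "M \<equiv> int (p ^ n)"
  shows "card {v \<in> {0..<M}. coprime v (int p) \<and> [v = f (int x)] (mod gcd M (fact x))} =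
    (if x < p then p - 1 else 1) * p ^ card {k \<in> {2..n}. \<not> p ^ k dvd fact x}"
proof (cases "x < p")
  case True
  have "\<not> p dvd fact x"
    using True \<open>prime p\<close> by (simp add: prime_dvd_fact_iff)
  then have nd: "\<not> p ^ k dvd fact x" if "k > 0" for k
    using that by (meson dvd_power dvd_trans)
  have "coprime p (fact x)"
    using \<open>\<not> p dvd fact x\<close> \<open>prime p\<close> by (simp add: prime_imp_coprime)
  then have "coprime (int p) (int (fact x))" by (simp only: coprime_int_iff)
  then have "gcd M (fact x) = 1" by (simp add: M_def)
  moreover have "{v \<in> {0..<M}. coprime v (int p)} = int ` totatives (p ^ n)"
  proof (intro equalityI subsetI)
    fix v assume v: "v \<in> {v \<in> {0..<M}. coprime v (int p)}"
    \<comment> \<open>\<open>totatives\<close> starts at 1, so the residue 0 has to be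
      excluded.\<close>
    then have "v \<noteq> 0" using prime_gt_1_nat[OF assms(1)] by auto
    with v obtain w where w: "v = int w" "w > 0" by (auto elim: nonneg_int_cases)
    with v have "coprime w p" "w < p ^ n" by (simp_all add: M_def flip: of_nat_power)
    with w show "v \<in> int ` totatives (p ^ n)" by (auto simp: totatives_def)
  next
    fix v assume "v \<in> int ` totatives (p ^ n)"
    then obtain w where w: "v = int w" "w \<in> totatives (p ^ n)" by blast
    have "p ^ n > 1" using prime_gt_1_nat[OF assms(1)] \<open>n > 0\<close> by (rule one_less_power)
    with w have "w < p ^ n" "coprime w p"
      using \<open>n > 0\<close> totatives_less by (auto simp: totatives_def)
    with w show "v \<in> {v \<in> {0..<M}. coprime v (int p)}"
      by (simp add: M_def flip: of_nat_power)
  qed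
  moreover have "{k \<in> {2..n}. \<not> p ^ k dvd fact x} = {2..n}" using nd by auto
  \<comment> \<open>The totient of \<open>p ^ n\<close> is \<open>(p - 1) * p ^ (n - 1)\<close>, and
    \<open>{2..n}\<close> has \<open>n - 1\<close> elements.\<close>
  ultimately show ?thesis
    using True assms(1,2) by (simp add: card_image totient_prime_power flip: totient_def)
next
  case False
  obtain t where t: "t \<le> n" "gcd (p ^ n) (fact x) = p ^ t"
    using divides_primepow_nat[OF \<open>prime p\<close>, THEN iffD1, OF gcd_dvd1] by blast
  have p1: "p > 1" using assms(1) prime_gt_1_nat by blast
  have iff: "p ^ k dvd fact x \<longleftrightarrow> k \<le> t" if "k \<le> n" for k
  proof -
    have "p ^ k dvd fact x \<longleftrightarrow> p ^ k dvd p ^ t"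
      using that by (simp add: le_imp_power_dvd flip: t(2))
    then show ?thesis using p1 by (auto dest: power_dvd_imp_le intro: le_imp_power_dvd)
  qed
  have "t \<ge> 1"
    using iff[of 1] False \<open>n > 0\<close> assms(1) by (simp add: prime_dvd_fact_iff)
  have g: "gcd M (fact x) = int (p ^ t)"
    unfolding M_def t(2)[symmetric] by (metis gcd_int_int_eq of_nat_fact)
  \<comment> \<open>Since \<open>x - p\<close> lies in the range where \<open>f\<close> is known to
    be a unit, periodicity modulo \<open>p\<close> makes \<open>f (int x)\<close> a unit too. The
    modulus is written \<open>p ^ 1\<close> to match
    \<open>coprime_prime_power_cong\<close>.\<close>
  have "[f (int x) = f (int x - int p)] (mod int (p ^ 1))"
    by (rule int_polyfun_cong[OF f(1)]) (simp add: cong_iff_dvd_diff)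
  from coprime_prime_power_cong[OF this]
  have "coprime (f (int x)) (int p) \<longleftrightarrow> coprime (f (int x - int p)) (int p)"
    by simp
  also have "\<dots>" using f(2)[rule_format, of "int x - int p"] False p1 by auto
  finally have fx: "coprime (f (int x)) (int p)" .
  have cop: "coprime v (int p)" if "[v = f (int x)] (mod int (p ^ t))" for v
    using coprime_prime_power_cong[OF that] fx \<open>t \<ge> 1\<close> by auto
  have "{v \<in> {0..<M}. coprime v (int p) \<and> [v = f (int x)] (mod gcd M (fact x))} =
      {v \<in> {0..<M}. [v = f (int x)] (mod int (p ^ t))}"
    unfolding g using cop by auto
  moreover have "card {v \<in> {0..<M}. [v = f (int x)] (mod int (p ^ t))} = nat (M div int (p ^ t))"
    using p1 t(1) unfolding M_def by (intro card_cong_class) (auto simp: le_imp_power_dvd)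
  moreover have "nat (M div int (p ^ t)) = p ^ (n - t)"
    using p1 t(1) unfolding M_def by (simp add: power_diff flip: of_nat_power zdiv_int)
  \<comment> \<open>Starting at 2 loses nothing, as \<open>t >= 1\<close>; the set has
    \<open>n - t\<close> elements, the exponent just found.\<close>
  moreover have "{k \<in> {2..n}. \<not> p ^ k dvd fact x} = {t<..n}"
    using iff \<open>t \<ge> 1\<close> by auto
  ultimately show ?thesis using False by simp
qed

text \<open>Restriction to arguments below \<open>x\<close> maps the longer tables onto the shorter
  ones, and all fibres \<open>B s\<close> have the same size by
  \<open>card_extensions\<close>.\<close>

lemma card_unit_values_Suc:
  fixes p n x :: nat
  assumes "prime p" "n > 0"
  shows "card (unit_values p n (Suc x)) = card (unit_values p n x) *
    ((if x < p then p - 1 else 1) * p ^ card {k \<in> {2..n}. \<not> p ^ k dvd fact x})"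
    (is "_ = _ * ?c")
proof -
  have p0: "p > 0" using assms(1) prime_gt_0_nat by blast
  define B where "B s = {v. s(int x := v) \<in> unit_values p n (Suc x)}" for s
  have cardB: "card (B s) = ?c" if s: "s \<in> unit_values p n x" for s
  proof -
    obtain f where f: "s = (\<lambda>i\<in>{0..<int x}. f i mod int (p ^ n))" "int_polyfun f"
      "\<forall>i\<in>{0..<int x}. coprime (f i) (int p)"
      using s unfolding unit_values_def by blast
    show ?thesis
      unfolding B_def f(1) unit_values_extensions[OF p0 assms(2) f(2,3)]
      using card_extensions[OF assms f(2,3)] .
  qed
  \<comment> \<open>An infinite set has \<open>card\<close> 0, so a positive cardinality already
    yields finiteness of the fibres.\<close>
  have "c > 0 \<Longrightarrow> card A = c \<Longrightarrow> finite A" for A :: "int set" and c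
    using card_ge_0_finite by blast
  moreover have "?c > 0" using p0 prime_gt_1_nat[OF assms(1)] by simp
  ultimately have finB: "finite (B s)" if "s \<in> unit_values p n x" for s
    using cardB[OF that] by blast
  have "bij_betw (\<lambda>F. (restrict F {0..<int x}, F (int x)))
      (unit_values p n (Suc x)) (SIGMA s:unit_values p n x. B s)"
  proof (rule bij_betw_byWitness[where f' = "\<lambda>(s, v). s(int x := v)"])
    have ext: "F \<in> extensional {0..<int (Suc x)}" if "F \<in> unit_values p n (Suc x)" for F :: "int \<Rightarrow> int"
      using that by (auto simp: unit_values_def)
    have upd: "(restrict F {0..<int x})(int x := F (int x)) = F" if "F \<in> unit_values p n (Suc x)" for F :: "int \<Rightarrow> int"
      using ext[OF that] by (auto simp: fun_eq_iff extensional_def)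
    then show "\<forall>F\<in>unit_values p n (Suc x).
        (case (restrict F {0..<int x}, F (int x)) of (s, v) \<Rightarrow> s(int x := v)) = F"
      by simp
    have "restrict (s(int x := v)) {0..<int x} = s" if "s \<in> unit_values p n x" for s v
      using that by (auto simp: unit_values_def fun_eq_iff)
    then show "\<forall>sv\<in>(SIGMA s:unit_values p n x. B s).
        (restrict (case sv of (s, v) \<Rightarrow> s(int x := v)) {0..<int x},
         (case sv of (s, v) \<Rightarrow> s(int x := v)) (int x)) = sv"
      by auto
    have "restrict F {0..<int x} \<in> unit_values p n x" if F: "F \<in> unit_values p n (Suc x)" for F :: "int \<Rightarrow> int"
    proof -
      obtain f where "F = (\<lambda>i\<in>{0..<int (Suc x)}. f i mod int (p ^ n))" "int_polyfun f"
        "\<forall>i\<in>{0..<int (Suc x)}. coprime (f i) (int p)"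
        using F unfolding unit_values_def by blast
      then show ?thesis
        unfolding unit_values_def by (intro CollectI exI[of _ f]) (auto simp: fun_eq_iff)
    qed
    with upd show "(\<lambda>F. (restrict F {0..<int x}, F (int x))) ` unit_values p n (Suc x)
        \<subseteq> (SIGMA s:unit_values p n x. B s)"
      by (auto simp: B_def)
    show "(\<lambda>(s, v). s(int x := v)) ` (SIGMA s:unit_values p n x. B s) \<subseteq> unit_values p n (Suc x)"
      by (auto simp: B_def)
  qed
  then have "card (unit_values p n (Suc x)) = (\<Sum>s\<in>unit_values p n x. card (B s))"
    using finite_unit_values[OF p0] finB by (simp add: bij_betw_same_card card_SigmaI)
  also have "\<dots> = card (unit_values p n x) * ?c"
    using cardB by simp
  finally show ?thesis .
qed

lemma card_unit_values:
  fixes p n x :: nat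
  assumes "prime p" "n > 0"
  shows "card (unit_values p n x) =
    (\<Prod>y<x. (if y < p then p - 1 else 1) * p ^ card {k \<in> {2..n}. \<not> p ^ k dvd fact y})"
proof (induction x)
  case 0
  \<comment> \<open>There is exactly one empty table, matching the empty product.\<close>
  have "unit_values p n 0 = {\<lambda>i\<in>{}. undefined}"
    by (auto simp: unit_values_def fun_eq_iff intro: int_polyfun.intros)
  then show ?case by simp
next
  case (Suc x)
  then show ?case by (simp add: card_unit_values_Suc[OF assms] mult.commute)
qed

section \<open>The function beta and the final count\<close>

text \<open>Divisibility of \<open>fact y\<close> by \<open>p ^ k\<close> persists as
  \<open>y\<close> grows, so it sets in exactly at \<open>beta p k\<close>. The minimum ranges over
  positive integers; \<open>k > 0\<close> settles \<open>y = 0\<close>, where the factorial is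
  1.\<close>

lemma not_dvd_fact_iff_less_beta:
  assumes "prime p" "k > 0"
  shows "\<not> p ^ k dvd fact y \<longleftrightarrow> y < beta p k"
proof -
  have p: "p > 1" using assms(1) prime_gt_1_nat by blast
  have "p ^ k > 0 \<and> p ^ k dvd fact (p ^ k)" using p by (simp add: dvd_fact)
  then have beta: "beta p k > 0" "p ^ k dvd fact (beta p k)"
    unfolding beta_def by (metis (mono_tags, lifting) LeastI)+
  have "\<not> p ^ k dvd fact 0" using p assms(2) by simp
  moreover have "beta p k \<le> y" if "y > 0" "p ^ k dvd fact y"
    unfolding beta_def using that by (intro Least_le) auto
  moreover have "p ^ k dvd fact y" if "beta p k \<le> y"
    using beta(2) fact_dvd[OF that] by (rule dvd_trans)
  ultimately show ?thesis by (metis not_less gr0I)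
qed

theorem theorem5p6:
  fixes p n :: nat
  assumes "prime p" and "n > 1"
  shows "order (units_of (poly_function_ring (residue_ring (int (p ^ n))))) =
           (p - 1) ^ p * p ^ (\<Sum>k = 2..n. beta p k)"
proof -
  define M where "M = p ^ n"
  have p: "p > 1" using assms(1) prime_gt_1_nat by blast
  have "M > 1" using one_less_power[OF p, of n] assms(2) by (simp add: M_def)
  interpret residues "int M" "residue_ring (int M)"
    by unfold_locales (use \<open>M > 1\<close> in auto)
  have "coprime a (int M) \<longleftrightarrow> coprime a (int p)" for a :: int
    using assms(2) by (simp add: M_def)
  then have "Units (poly_function_ring (residue_ring (int M))) = unit_values p n M"
    unfolding Units_poly_function_ring unit_values_def by (simp add: M_def)
  then have "order (units_of (poly_function_ring (residue_ring (int M)))) =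
      (\<Prod>y<M. (if y < p then p - 1 else 1) * p ^ card {k \<in> {2..n}. \<not> p ^ k dvd fact y})"
    using card_unit_values[OF assms(1), of n M] assms(2)
    by (simp add: order_def units_of_carrier)
  also have "\<dots> = (\<Prod>y<M. if y < p then p - 1 else 1) *
      p ^ (\<Sum>y<M. card {k \<in> {2..n}. \<not> p ^ k dvd fact y})"
    by (simp add: prod.distrib power_sum)
  also have "(\<Prod>y<M. if y < p then p - 1 else 1) = (p - 1) ^ p"
  proof -
    \<comment> \<open>All \<open>p\<close> arguments that contribute a factor \<open>p - 1\<close>
      lie below \<open>M\<close>.\<close>
    have "p \<le> M" using p assms(2) by (simp add: M_def self_le_power)
    then have "{..<M} \<inter> {y. y < p} = {..<p}" by auto
    then show ?thesis by (simp add: prod.If_cases)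
  qed
  also have "(\<Sum>y<M. card {k \<in> {2..n}. \<not> p ^ k dvd fact y}) =
      (\<Sum>y<M. \<Sum>k = 2..n. of_bool (y < beta p k))"
    using assms(1) by (intro sum.cong refl) (simp add: not_dvd_fact_iff_less_beta Int_def cong: conj_cong)
  also have "\<dots> = (\<Sum>k = 2..n. \<Sum>y<M. of_bool (y < beta p k))"
    by (rule sum.swap)
  also have "\<dots> = (\<Sum>k = 2..n. beta p k)"
  proof (intro sum.cong refl)
    fix k assume k: "k \<in> {2..n}"
    \<comment> \<open>This gives \<open>beta p k\<close> at most \<open>M\<close>, so the cutoff
      \<open>y < M\<close> does not truncate the count of the \<open>y\<close> below
      \<open>beta p k\<close>.\<close>
    have "p ^ n dvd fact M" using p by (simp add: M_def dvd_fact)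
    then have "p ^ k dvd fact M" using k by (meson atLeastAtMost_iff dvd_trans le_imp_power_dvd)
    then have "beta p k \<le> M"
      using not_dvd_fact_iff_less_beta[OF assms(1), of k M] k by auto
    then have "{..<M} \<inter> {y. y < beta p k} = {..<beta p k}" by auto
    then show "(\<Sum>y<M. of_bool (y < beta p k)) = beta p k" by simp
  qed
  finally show ?thesis by (simp add: M_def)
qed

end
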